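(* Let $(\mathcal{C},\otimes,F,G,a,\Phi,d)$ be a weakly hom-braided category. Then $d$ has the weak hom-Yang-Baxter property, that is, for all objects $U,V,W$ of $\mathcal{C}$ the following two morphisms $(U\otimes V)\otimes F(W)\to FG^3(W)\otimes(G^3(V)\otimes G^3(U))$ are equal: $$a_{G^3(W),G^3(V),G^3(U)}\circ(d_{G^2(V),G^2(W)}\otimes\Phi_{G^2F(U)})\circ a^{-1}_{G^2(V),G^2(W),G^2(U)}\circ(\Phi_{GF(V)}\otimes d_{G(U),G(W)})\circ a_{G(V),G(U),G(W)}\circ(d_{U,V}\otimes\Phi_{F(W)})$$ $$=(\Phi_{G^2F(W)}\otimes d_{G^2(U),G^2(V)})\circ a_{G^2(W),G^2(U),G^2(V)}\circ(d_{G(U),G(W)}\otimes\Phi_{GF(V)})\circ a^{-1}_{G(U),G(W),G(V)}\circ(\Phi_{F(U)}\otimes d_{V,W})\circ a_{U,V,W}.$$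
   Context: A hom-tensor category is a 6-tuple $(\mathcal{C},\otimes,F,G,a,\Phi)$ where: $\mathcal{C}$ is a category; $\otimes:\mathcal{C}\times\mathcal{C}\to\mathcal{C}$ is a functor; $F,G:\mathcal{C}\to\mathcal{C}$ are functors with $F(U\otimes V)=F(U)\otimes F(V)$, $F(f\otimes g)=F(f)\otimes F(g)$, and likewise $G(U\otimes V)=G(U)\otimes G(V)$, $G(f\otimes g)=G(f)\otimes G(g)$, for all objects $U,V$ and morphisms $f,g$; $FG=GF$; $a_{X,Y,Z}:(X\otimes Y)\otimes F(Z)\to F(X)\otimes(Y\otimes Z)$ is a natural isomorphism satisfying, for all objects $X,Y,Z,T$, $$a_{F(X),F(Y),Z\otimes T}\circ a_{X\otimes Y,F(Z),F(T)}=(\mathrm{id}_{F^2(X)}\otimes a_{Y,Z,T})\circ a_{F(X),Y\otimes Z,F(T)}\circ(a_{X,Y,Z}\otimes \mathrm{id}_{F^2(T)});$$ $\Phi:\mathrm{id}_{\mathcal{C}}\to G$ is a natural transformation with $F(\Phi_U)=\Phi_{F(U)}$, $G(\Phi_U)=\Phi_{G(U)}$ and $\Phi_{M\otimes N}=\Phi_M\otimes\Phi_N$ for all objects $U,M,N$. No unit object is required. A weak hom-braiding $d$ in a hom-tensor category is a family of morphisms $d_{V,W}:V\otimes W\to G(W)\otimes G(V)$, natural in $V,W$ (i.e. $(G(g)\otimes G(f))\circ d_{V,W}=d_{V',W'}\circ(f\otimes g)$ for all $f:V\to V'$, $g:W\to W'$), with $G(d_{U,V})=d_{G(U),G(V)}$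 for all $U,V$, and satisfying for all objects $U,V,W$: (wH1) $(\Phi_{GF(V)}\otimes(\Phi_{G(W)}\otimes\Phi_{G(U)}))\circ a_{G(V),G(W),G(U)}\circ d_{F(U),V\otimes W}\circ a_{U,V,W}=(\Phi_{GF(V)}\otimes d_{G(U),G(W)})\circ a_{G(V),G(U),G(W)}\circ(d_{U,V}\otimes\Phi_{F(W)})$; (wH2) $((\Phi_{G(W)}\otimes\Phi_{G(U)})\otimes\Phi_{GF(V)})\circ a^{-1}_{G(W),G(U),G(V)}\circ d_{U\otimes V,F(W)}\circ a^{-1}_{U,V,W}=(d_{G(U),G(W)}\otimes\Phi_{GF(V)})\circ a^{-1}_{G(U),G(W),G(V)}\circ(\Phi_{F(U)}\otimes d_{V,W})$. A weakly hom-braided category $(\mathcal{C},\otimes,F,G,a,\Phi,d)$ is a hom-tensor category with a weak hom-braiding $d$. *)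

theory Defs
  imports Main
begin

section \<open>Categories, functors and natural transformations\<close>

record ('o, 'a) cat =
  Obj :: "'o set"
  Arr :: "'a set"
  Dom :: "'a \<Rightarrow> 'o"
  Cod :: "'a \<Rightarrow> 'o"
  Id :: "'o \<Rightarrow> 'a"
  Comp :: "'a \<Rightarrow> 'a \<Rightarrow> 'a"

text \<open>\<open>Comp C g f\<close> is \<open>g\<close> after \<open>f\<close>; it is a total function whose value is meaningful only for
  composable arrows of \<open>C\<close>.\<close>

definition hom :: "('o, 'a, 'm) cat_scheme \<Rightarrow> 'o \<Rightarrow> 'o \<Rightarrow> 'a set" where
  "hom C X Y = {f \<in> Arr C. Dom C f = X \<and> Cod C f = Y}"

locale category =
  fixes C :: "('o, 'a) cat"
  assumes Dom_in_Obj: "f \<in> Arr C \<Longrightarrow> Dom C f \<in> Obj C"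
    and Cod_in_Obj: "f \<in> Arr C \<Longrightarrow> Cod C f \<in> Obj C"
    and Id_in_hom: "X \<in> Obj C \<Longrightarrow> Id C X \<in> hom C X X"
    and Comp_in_hom: "\<lbrakk>f \<in> hom C X Y; g \<in> hom C Y Z\<rbrakk> \<Longrightarrow> Comp C g f \<in> hom C X Z"
    and Comp_Id_right: "f \<in> hom C X Y \<Longrightarrow> Comp C f (Id C X) = f"
    and Comp_Id_left: "f \<in> hom C X Y \<Longrightarrow> Comp C (Id C Y) f = f"
    and Comp_assoc: "\<lbrakk>f \<in> hom C X Y; g \<in> hom C Y Z; h \<in> hom C Z T\<rbrakk>
      \<Longrightarrow> Comp C (Comp C h g) f = Comp C h (Comp C g f)"

definition inverse_arrows :: "('o, 'a) cat \<Rightarrow> 'a \<Rightarrow> 'a \<Rightarrow> bool" where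
  "inverse_arrows C f g \<longleftrightarrow> f \<in> Arr C \<and> g \<in> hom C (Cod C f) (Dom C f)
     \<and> Comp C g f = Id C (Dom C f) \<and> Comp C f g = Id C (Cod C f)"

definition iso_arrow :: "('o, 'a) cat \<Rightarrow> 'a \<Rightarrow> bool" where
  "iso_arrow C f \<longleftrightarrow> (\<exists>g. inverse_arrows C f g)"

definition inv_arrow :: "('o, 'a) cat \<Rightarrow> 'a \<Rightarrow> 'a" where
  "inv_arrow C f = (THE g. inverse_arrows C f g)"

definition prod_cat :: "('o, 'a) cat \<Rightarrow> ('p, 'b) cat \<Rightarrow> ('o \<times> 'p, 'a \<times> 'b) cat" where
  "prod_cat C D =
    \<lparr>Obj = Obj C \<times> Obj D,
     Arr = Arr C \<times> Arr D,
     Dom = (\<lambda>(f, g). (Dom C f, Dom D g)),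
     Cod = (\<lambda>(f, g). (Cod C f, Cod D g)),
     Id = (\<lambda>(X, Y). (Id C X, Id D Y)),
     Comp = (\<lambda>(f', g') (f, g). (Comp C f' f, Comp D g' g))\<rparr>"

record ('o, 'a, 'p, 'b) func =
  fobj :: "'o \<Rightarrow> 'p"
  farr :: "'a \<Rightarrow> 'b"

definition id_func :: "('o, 'a, 'o, 'a) func" where
  "id_func = \<lparr>fobj = (\<lambda>X. X), farr = (\<lambda>f. f)\<rparr>"

locale cat_functor =
  source: category C + target: category D
  for C :: "('o, 'a) cat" and D :: "('p, 'b) cat" +
  fixes S :: "('o, 'a, 'p, 'b) func"
  assumes fobj_in_Obj: "X \<in> Obj C \<Longrightarrow> fobj S X \<in> Obj D"
    and farr_in_hom: "f \<in> hom C X Y \<Longrightarrow> farr S f \<in> hom D (fobj S X) (fobj S Y)"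
    and farr_Id: "X \<in> Obj C \<Longrightarrow> farr S (Id C X) = Id D (fobj S X)"
    and farr_Comp: "\<lbrakk>f \<in> hom C X Y; g \<in> hom C Y Z\<rbrakk>
      \<Longrightarrow> farr S (Comp C g f) = Comp D (farr S g) (farr S f)"

locale nat_trans =
  dom_functor: cat_functor C D S + cod_functor: cat_functor C D T
  for C :: "('o, 'a) cat" and D :: "('p, 'b) cat"
    and S :: "('o, 'a, 'p, 'b) func" and T :: "('o, 'a, 'p, 'b) func" +
  fixes \<eta> :: "'o \<Rightarrow> 'b"
  assumes component_in_hom: "X \<in> Obj C \<Longrightarrow> \<eta> X \<in> hom D (fobj S X) (fobj T X)"
    and naturality: "f \<in> hom C X Y
      \<Longrightarrow> Comp D (farr T f) (\<eta> X) = Comp D (\<eta> Y) (farr S f)"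

locale nat_iso = nat_trans +
  assumes component_iso: "X \<in> Obj C \<Longrightarrow> iso_arrow D (\<eta> X)"


section \<open>Hom-tensor categories\<close>

text \<open>The signature only, so that the notation is available for stating the axioms. The letter
  \<open>P\<close> stands for the tensor product functor; the subscripts \<open>o\<close> and \<open>a\<close> mark the actions on
  objects and on arrows.\<close>

locale hom_tensor_data =
  fixes C :: "('o, 'a) cat"
    and P :: "('o \<times> 'o, 'a \<times> 'a, 'o, 'a) func"
    and F :: "('o, 'a, 'o, 'a) func"
    and G :: "('o, 'a, 'o, 'a) func"
    and a :: "'o \<Rightarrow> 'o \<Rightarrow> 'o \<Rightarrow> 'a"
    and \<Phi> :: "'o \<Rightarrow> 'a"
begin

abbreviation comp (infixr "\<cdot>" 55) where "g \<cdot> f \<equiv> Comp C g f"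
abbreviation tensor_obj (infixr "\<otimes>\<^sub>o" 70) where "X \<otimes>\<^sub>o Y \<equiv> fobj P (X, Y)"
abbreviation tensor_arr (infixr "\<otimes>\<^sub>a" 70) where "f \<otimes>\<^sub>a g \<equiv> farr P (f, g)"
abbreviation F\<^sub>o where "F\<^sub>o \<equiv> fobj F"
abbreviation F\<^sub>a where "F\<^sub>a \<equiv> farr F"
abbreviation G\<^sub>o where "G\<^sub>o \<equiv> fobj G"
abbreviation G\<^sub>a where "G\<^sub>a \<equiv> farr G"
abbreviation a_inv where "a_inv X Y Z \<equiv> inv_arrow C (a X Y Z)"

end

locale hom_tensor_category = hom_tensor_data C P F G a \<Phi>
  for C :: "('o, 'a) cat"
    and P :: "('o \<times> 'o, 'a \<times> 'a, 'o, 'a) func"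
    and F :: "('o, 'a, 'o, 'a) func"
    and G :: "('o, 'a, 'o, 'a) func"
    and a :: "'o \<Rightarrow> 'o \<Rightarrow> 'o \<Rightarrow> 'a"
    and \<Phi> :: "'o \<Rightarrow> 'a" +
  assumes category: "category C"
    and tensor_functor: "cat_functor (prod_cat C C) C P"
    and F_functor: "cat_functor C C F"
    and G_functor: "cat_functor C C G"
    and F_tensor_obj: "\<lbrakk>U \<in> Obj C; V \<in> Obj C\<rbrakk> \<Longrightarrow> F\<^sub>o (U \<otimes>\<^sub>o V) = F\<^sub>o U \<otimes>\<^sub>o F\<^sub>o V"
    and F_tensor_arr: "\<lbrakk>f \<in> Arr C; g \<in> Arr C\<rbrakk> \<Longrightarrow> F\<^sub>a (f \<otimes>\<^sub>a g) = F\<^sub>a f \<otimes>\<^sub>a F\<^sub>a g"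
    and G_tensor_obj: "\<lbrakk>U \<in> Obj C; V \<in> Obj C\<rbrakk> \<Longrightarrow> G\<^sub>o (U \<otimes>\<^sub>o V) = G\<^sub>o U \<otimes>\<^sub>o G\<^sub>o V"
    and G_tensor_arr: "\<lbrakk>f \<in> Arr C; g \<in> Arr C\<rbrakk> \<Longrightarrow> G\<^sub>a (f \<otimes>\<^sub>a g) = G\<^sub>a f \<otimes>\<^sub>a G\<^sub>a g"
    and FG_obj: "U \<in> Obj C \<Longrightarrow> F\<^sub>o (G\<^sub>o U) = G\<^sub>o (F\<^sub>o U)"
    and FG_arr: "f \<in> Arr C \<Longrightarrow> F\<^sub>a (G\<^sub>a f) = G\<^sub>a (F\<^sub>a f)"
    and assoc_nat_iso: "nat_iso (prod_cat C (prod_cat C C)) C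
      \<lparr>fobj = (\<lambda>(X, Y, Z). (X \<otimes>\<^sub>o Y) \<otimes>\<^sub>o F\<^sub>o Z),
       farr = (\<lambda>(f, g, h). (f \<otimes>\<^sub>a g) \<otimes>\<^sub>a F\<^sub>a h)\<rparr>
      \<lparr>fobj = (\<lambda>(X, Y, Z). F\<^sub>o X \<otimes>\<^sub>o (Y \<otimes>\<^sub>o Z)),
       farr = (\<lambda>(f, g, h). F\<^sub>a f \<otimes>\<^sub>a (g \<otimes>\<^sub>a h))\<rparr>
      (\<lambda>(X, Y, Z). a X Y Z)"
    and pentagon: "\<lbrakk>X \<in> Obj C; Y \<in> Obj C; Z \<in> Obj C; T \<in> Obj C\<rbrakk> \<Longrightarrow>
      a (F\<^sub>o X) (F\<^sub>o Y) (Z \<otimes>\<^sub>o T) \<cdot> a (X \<otimes>\<^sub>o Y) (F\<^sub>o Z) (F\<^sub>o T)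
      = (Id C (F\<^sub>o (F\<^sub>o X)) \<otimes>\<^sub>a a Y Z T) \<cdot> a (F\<^sub>o X) (Y \<otimes>\<^sub>o Z) (F\<^sub>o T)
        \<cdot> (a X Y Z \<otimes>\<^sub>a Id C (F\<^sub>o (F\<^sub>o T)))"
    and \<Phi>_nat_trans: "nat_trans C C id_func G \<Phi>"
    and F_\<Phi>: "U \<in> Obj C \<Longrightarrow> F\<^sub>a (\<Phi> U) = \<Phi> (F\<^sub>o U)"
    and G_\<Phi>: "U \<in> Obj C \<Longrightarrow> G\<^sub>a (\<Phi> U) = \<Phi> (G\<^sub>o U)"
    and \<Phi>_tensor: "\<lbrakk>M \<in> Obj C; N \<in> Obj C\<rbrakk> \<Longrightarrow> \<Phi> (M \<otimes>\<^sub>o N) = \<Phi> M \<otimes>\<^sub>a \<Phi> N"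


section \<open>Weak hom-braidings and the weak hom-Yang-Baxter property\<close>

locale weakly_hom_braided_category = hom_tensor_category C P F G a \<Phi>
  for C :: "('o, 'a) cat"
    and P :: "('o \<times> 'o, 'a \<times> 'a, 'o, 'a) func"
    and F :: "('o, 'a, 'o, 'a) func"
    and G :: "('o, 'a, 'o, 'a) func"
    and a :: "'o \<Rightarrow> 'o \<Rightarrow> 'o \<Rightarrow> 'a"
    and \<Phi> :: "'o \<Rightarrow> 'a" +
  fixes d :: "'o \<Rightarrow> 'o \<Rightarrow> 'a"
  assumes d_nat_trans: "nat_trans (prod_cat C C) C P
      \<lparr>fobj = (\<lambda>(V, W). G\<^sub>o W \<otimes>\<^sub>o G\<^sub>o V), farr = (\<lambda>(f, g). G\<^sub>a g \<otimes>\<^sub>a G\<^sub>a f)\<rparr>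
      (\<lambda>(V, W). d V W)"
    and G_d: "\<lbrakk>U \<in> Obj C; V \<in> Obj C\<rbrakk> \<Longrightarrow> G\<^sub>a (d U V) = d (G\<^sub>o U) (G\<^sub>o V)"
    and wH1: "\<lbrakk>U \<in> Obj C; V \<in> Obj C; W \<in> Obj C\<rbrakk> \<Longrightarrow>
      (\<Phi> (G\<^sub>o (F\<^sub>o V)) \<otimes>\<^sub>a (\<Phi> (G\<^sub>o W) \<otimes>\<^sub>a \<Phi> (G\<^sub>o U))) \<cdot> a (G\<^sub>o V) (G\<^sub>o W) (G\<^sub>o U)
        \<cdot> d (F\<^sub>o U) (V \<otimes>\<^sub>o W) \<cdot> a U V W
      = (\<Phi> (G\<^sub>o (F\<^sub>o V)) \<otimes>\<^sub>a d (G\<^sub>o U) (G\<^sub>o W)) \<cdot> a (G\<^sub>o V) (G\<^sub>o U) (G\<^sub>o W)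
        \<cdot> (d U V \<otimes>\<^sub>a \<Phi> (F\<^sub>o W))"
    and wH2: "\<lbrakk>U \<in> Obj C; V \<in> Obj C; W \<in> Obj C\<rbrakk> \<Longrightarrow>
      ((\<Phi> (G\<^sub>o W) \<otimes>\<^sub>a \<Phi> (G\<^sub>o U)) \<otimes>\<^sub>a \<Phi> (G\<^sub>o (F\<^sub>o V))) \<cdot> a_inv (G\<^sub>o W) (G\<^sub>o U) (G\<^sub>o V)
        \<cdot> d (U \<otimes>\<^sub>o V) (F\<^sub>o W) \<cdot> a_inv U V W
      = (d (G\<^sub>o U) (G\<^sub>o W) \<otimes>\<^sub>a \<Phi> (G\<^sub>o (F\<^sub>o V))) \<cdot> a_inv (G\<^sub>o U) (G\<^sub>o W) (G\<^sub>o V)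
        \<cdot> (\<Phi> (F\<^sub>o U) \<otimes>\<^sub>a d V W)"

context hom_tensor_data
begin

definition yang_baxter_left :: "('o \<Rightarrow> 'o \<Rightarrow> 'a) \<Rightarrow> 'o \<Rightarrow> 'o \<Rightarrow> 'o \<Rightarrow> 'a" where
  "yang_baxter_left d U V W =
     a (G\<^sub>o (G\<^sub>o (G\<^sub>o W))) (G\<^sub>o (G\<^sub>o (G\<^sub>o V))) (G\<^sub>o (G\<^sub>o (G\<^sub>o U)))
     \<cdot> (d (G\<^sub>o (G\<^sub>o V)) (G\<^sub>o (G\<^sub>o W)) \<otimes>\<^sub>a \<Phi> (G\<^sub>o (G\<^sub>o (F\<^sub>o U))))
     \<cdot> a_inv (G\<^sub>o (G\<^sub>o V)) (G\<^sub>o (G\<^sub>o W)) (G\<^sub>o (G\<^sub>o U))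
     \<cdot> (\<Phi> (G\<^sub>o (F\<^sub>o V)) \<otimes>\<^sub>a d (G\<^sub>o U) (G\<^sub>o W))
     \<cdot> a (G\<^sub>o V) (G\<^sub>o U) (G\<^sub>o W)
     \<cdot> (d U V \<otimes>\<^sub>a \<Phi> (F\<^sub>o W))"

definition yang_baxter_right :: "('o \<Rightarrow> 'o \<Rightarrow> 'a) \<Rightarrow> 'o \<Rightarrow> 'o \<Rightarrow> 'o \<Rightarrow> 'a" where
  "yang_baxter_right d U V W =
     (\<Phi> (G\<^sub>o (G\<^sub>o (F\<^sub>o W))) \<otimes>\<^sub>a d (G\<^sub>o (G\<^sub>o U)) (G\<^sub>o (G\<^sub>o V)))
     \<cdot> a (G\<^sub>o (G\<^sub>o W)) (G\<^sub>o (G\<^sub>o U)) (G\<^sub>o (G\<^sub>o V))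
     \<cdot> (d (G\<^sub>o U) (G\<^sub>o W) \<otimes>\<^sub>a \<Phi> (G\<^sub>o (F\<^sub>o V)))
     \<cdot> a_inv (G\<^sub>o U) (G\<^sub>o W) (G\<^sub>o V)
     \<cdot> (\<Phi> (F\<^sub>o U) \<otimes>\<^sub>a d V W)
     \<cdot> a U V W"

text \<open>Since composition is total, the equality is accompanied by the assertion that both sides are
  arrows of the expected type.\<close>

definition weak_hom_Yang_Baxter :: "('o \<Rightarrow> 'o \<Rightarrow> 'a) \<Rightarrow> bool" where
  "weak_hom_Yang_Baxter d \<longleftrightarrow> (\<forall>U \<in> Obj C. \<forall>V \<in> Obj C. \<forall>W \<in> Obj C.
     (let H = hom C ((U \<otimes>\<^sub>o V) \<otimes>\<^sub>o F\<^sub>o W)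
          (F\<^sub>o (G\<^sub>o (G\<^sub>o (G\<^sub>o W))) \<otimes>\<^sub>o (G\<^sub>o (G\<^sub>o (G\<^sub>o V)) \<otimes>\<^sub>o G\<^sub>o (G\<^sub>o (G\<^sub>o U))))
      in yang_baxter_left d U V W \<in> H \<and> yang_baxter_right d U V W \<in> H
       \<and> yang_baxter_left d U V W = yang_baxter_right d U V W))"

end

end

theory Submission
  imports Defs
begin

text \<open>
  Axiom \<open>wH1\<close> says that, up to transformations \<open>\<Phi>\<close>, moving \<open>U\<close> past \<open>V\<close> and then past \<open>W\<close> is the
  same as moving it past \<open>V \<otimes> W\<close> in one step. In the left-hand side of the Yang-Baxter equation the
  object \<open>U\<close> moves first, so \<open>wH1\<close> merges its two crossings into the single crossing
  \<open>d (F U) (V \<otimes> W)\<close>. What remains after it is the crossing of \<open>V\<close> with \<open>W\<close>, and since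
  \<open>G (d V W) = d (G V) (G W)\<close>, naturality of \<open>d\<close> slides this crossing to the
  other side of the merged one. There \<open>wH1\<close> for \<open>G U, G W, G V\<close> splits the merged crossing again,
  now into \<open>U\<close> past \<open>W\<close> followed by \<open>U\<close> past \<open>V\<close>, and this is the right-hand side.

  The transformations \<open>\<Phi>\<close> produced by the merging never obstruct this: they pass through
  associators by naturality of \<open>a\<close> together with \<open>F (\<Phi> U) = \<Phi> (F U)\<close>
  (lemmas \<open>a_\<Phi>\<close> and \<open>a_inv_\<Phi>\<close>), through crossings by naturality of \<open>d\<close> together with
  \<open>G (\<Phi> U) = \<Phi> (G U)\<close> (lemma \<open>d_\<Phi>\<close>), and arrive at exactly the place where the second application
  of \<open>wH1\<close> expects them.
\<close>

section \<open>Composition and inverses in a category\<close>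

text \<open>Typing conditions are phrased through \<open>Arr\<close>, \<open>Dom\<close> and \<open>Cod\<close> rather than \<open>hom\<close>, because the
  intermediate object of a composite can then be computed by rewriting.\<close>

context category
begin

lemma Comp_arr:
  assumes "f \<in> Arr C" "g \<in> Arr C" "Dom C g = Cod C f"
  shows "Comp C g f \<in> Arr C" "Dom C (Comp C g f) = Dom C f" "Cod C (Comp C g f) = Cod C g"
  using Comp_in_hom[of f "Dom C f" "Cod C f" g "Cod C g"] assms by (auto simp: hom_def)

lemma Comp_assoc_arr:
  assumes "f \<in> Arr C" "g \<in> Arr C" "h \<in> Arr C" "Dom C g = Cod C f" "Dom C h = Cod C g"
  shows "Comp C (Comp C h g) f = Comp C h (Comp C g f)"
  using Comp_assoc[of f "Dom C f" "Cod C f" g "Cod C g" h "Cod C h"] assms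
  by (auto simp: hom_def)

lemma Comp_Id_left_arr:
  assumes "f \<in> Arr C" "Cod C f = X"
  shows "Comp C (Id C X) f = f"
  using Comp_Id_left[of f "Dom C f" X] assms by (simp add: hom_def)

lemma Comp_Id_right_arr:
  assumes "f \<in> Arr C" "Dom C f = X"
  shows "Comp C f (Id C X) = f"
  using Comp_Id_right[of f X "Cod C f"] assms by (simp add: hom_def)

lemma inverse_arrows_unique:
  assumes g: "inverse_arrows C f g" and h: "inverse_arrows C f h"
  shows "g = h"
proof -
  have "g = Comp C g (Comp C f h)"
    using g h by (simp add: inverse_arrows_def hom_def Comp_Id_right_arr)
  also have "\<dots> = Comp C (Comp C g f) h"
    using g h Comp_assoc_arr[of h f g] by (simp add: inverse_arrows_def hom_def)
  also have "\<dots> = h"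
    using g h by (simp add: inverse_arrows_def hom_def Comp_Id_left_arr)
  finally show ?thesis .
qed

lemma inverse_arrows_inv_arrow:
  assumes "iso_arrow C f"
  shows "inverse_arrows C f (inv_arrow C f)"
  using assms theI[of "inverse_arrows C f"] inverse_arrows_unique
  unfolding iso_arrow_def inv_arrow_def by metis

end

section \<open>Associators and the transformation \<open>\<Phi>\<close>\<close>

context hom_tensor_category
begin

lemmas comp_arr = category.Comp_arr[OF category]
lemmas comp_assoc = category.Comp_assoc_arr[OF category]
lemmas comp_Id_left = category.Comp_Id_left_arr[OF category]

lemma tensor_obj_closed: "\<lbrakk>X \<in> Obj C; Y \<in> Obj C\<rbrakk> \<Longrightarrow> X \<otimes>\<^sub>o Y \<in> Obj C"
  using cat_functor.fobj_in_Obj[OF tensor_functor, of "(X, Y)"] by (simp add: prod_cat_def)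

lemma F_obj_closed: "X \<in> Obj C \<Longrightarrow> F\<^sub>o X \<in> Obj C"
  by (rule cat_functor.fobj_in_Obj[OF F_functor])

lemma G_obj_closed: "X \<in> Obj C \<Longrightarrow> G\<^sub>o X \<in> Obj C"
  by (rule cat_functor.fobj_in_Obj[OF G_functor])

lemma tensor_arr:
  assumes "f \<in> Arr C" "g \<in> Arr C"
  shows "f \<otimes>\<^sub>a g \<in> Arr C" "Dom C (f \<otimes>\<^sub>a g) = Dom C f \<otimes>\<^sub>o Dom C g"
    "Cod C (f \<otimes>\<^sub>a g) = Cod C f \<otimes>\<^sub>o Cod C g"
  using cat_functor.farr_in_hom[OF tensor_functor, of "(f, g)" "(Dom C f, Dom C g)"
      "(Cod C f, Cod C g)"] assms
  by (auto simp: prod_cat_def hom_def)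

lemma interchange:
  assumes "f \<in> Arr C" "g \<in> Arr C" "f' \<in> Arr C" "g' \<in> Arr C"
    and "Dom C f' = Cod C f" "Dom C g' = Cod C g"
  shows "(f' \<otimes>\<^sub>a g') \<cdot> (f \<otimes>\<^sub>a g) = (f' \<cdot> f) \<otimes>\<^sub>a (g' \<cdot> g)"
  using cat_functor.farr_Comp[OF tensor_functor, of "(f, g)" "(Dom C f, Dom C g)"
      "(Cod C f, Cod C g)" "(f', g')" "(Cod C f', Cod C g')"] assms
  by (simp add: prod_cat_def hom_def)

lemma \<Phi>_arr:
  assumes "X \<in> Obj C"
  shows "\<Phi> X \<in> Arr C" "Dom C (\<Phi> X) = X" "Cod C (\<Phi> X) = G\<^sub>o X"
  using nat_trans.component_in_hom[OF \<Phi>_nat_trans assms] by (auto simp: hom_def id_func_def)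

lemma a_arr:
  assumes "X \<in> Obj C" "Y \<in> Obj C" "Z \<in> Obj C"
  shows "a X Y Z \<in> Arr C" "Dom C (a X Y Z) = (X \<otimes>\<^sub>o Y) \<otimes>\<^sub>o F\<^sub>o Z"
    "Cod C (a X Y Z) = F\<^sub>o X \<otimes>\<^sub>o (Y \<otimes>\<^sub>o Z)"
  using nat_trans.component_in_hom[OF nat_iso.axioms(1)[OF assoc_nat_iso], of "(X, Y, Z)"] assms
  by (auto simp: hom_def prod_cat_def)

lemma a_naturality:
  assumes "f \<in> Arr C" "g \<in> Arr C" "h \<in> Arr C"
  shows "(F\<^sub>a f \<otimes>\<^sub>a (g \<otimes>\<^sub>a h)) \<cdot> a (Dom C f) (Dom C g) (Dom C h)
    = a (Cod C f) (Cod C g) (Cod C h) \<cdot> ((f \<otimes>\<^sub>a g) \<otimes>\<^sub>a F\<^sub>a h)"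
  using nat_trans.naturality[OF nat_iso.axioms(1)[OF assoc_nat_iso],
      of "(f, g, h)" "(Dom C f, Dom C g, Dom C h)" "(Cod C f, Cod C g, Cod C h)"] assms
  by (simp add: hom_def prod_cat_def)

lemma a_inverse:
  assumes "X \<in> Obj C" "Y \<in> Obj C" "Z \<in> Obj C"
  shows "inverse_arrows C (a X Y Z) (a_inv X Y Z)"
  using nat_iso.component_iso[OF assoc_nat_iso, of "(X, Y, Z)"] assms
  by (intro category.inverse_arrows_inv_arrow[OF category]) (simp add: prod_cat_def)

lemma a_inv_arr:
  assumes "X \<in> Obj C" "Y \<in> Obj C" "Z \<in> Obj C"
  shows "a_inv X Y Z \<in> Arr C" "Dom C (a_inv X Y Z) = F\<^sub>o X \<otimes>\<^sub>o (Y \<otimes>\<^sub>o Z)"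
    "Cod C (a_inv X Y Z) = (X \<otimes>\<^sub>o Y) \<otimes>\<^sub>o F\<^sub>o Z"
  using a_inverse[OF assms] a_arr[OF assms] by (auto simp: inverse_arrows_def hom_def)

lemma a_inv_a_cancel:
  assumes "X \<in> Obj C" "Y \<in> Obj C" "Z \<in> Obj C"
    and "f \<in> Arr C" "Cod C f = (X \<otimes>\<^sub>o Y) \<otimes>\<^sub>o F\<^sub>o Z"
  shows "a_inv X Y Z \<cdot> a X Y Z \<cdot> f = f"
proof -
  have "a_inv X Y Z \<cdot> a X Y Z \<cdot> f = (a_inv X Y Z \<cdot> a X Y Z) \<cdot> f"
    using assms by (simp add: comp_assoc a_arr a_inv_arr)
  also have "\<dots> = f"
    using a_inverse[OF assms(1-3)] assms
    by (simp add: inverse_arrows_def a_arr comp_Id_left)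
  finally show ?thesis .
qed

lemma a_a_inv_cancel:
  assumes "X \<in> Obj C" "Y \<in> Obj C" "Z \<in> Obj C"
    and "f \<in> Arr C" "Cod C f = F\<^sub>o X \<otimes>\<^sub>o (Y \<otimes>\<^sub>o Z)"
  shows "a X Y Z \<cdot> a_inv X Y Z \<cdot> f = f"
proof -
  have "a X Y Z \<cdot> a_inv X Y Z \<cdot> f = (a X Y Z \<cdot> a_inv X Y Z) \<cdot> f"
    using assms by (simp add: comp_assoc a_arr a_inv_arr)
  also have "\<dots> = f"
    using a_inverse[OF assms(1-3)] assms
    by (simp add: inverse_arrows_def a_arr comp_Id_left)
  finally show ?thesis .
qed

lemmas typing = comp_arr tensor_arr \<Phi>_arr a_arr a_inv_arr
  tensor_obj_closed F_obj_closed G_obj_closed FG_obj F_tensor_obj G_tensor_obj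

lemma a_\<Phi>:
  assumes "X \<in> Obj C" "Y \<in> Obj C" "Z \<in> Obj C"
  shows "a (G\<^sub>o X) (G\<^sub>o Y) (G\<^sub>o Z) \<cdot> ((\<Phi> X \<otimes>\<^sub>a \<Phi> Y) \<otimes>\<^sub>a \<Phi> (F\<^sub>o Z))
    = (\<Phi> (F\<^sub>o X) \<otimes>\<^sub>a (\<Phi> Y \<otimes>\<^sub>a \<Phi> Z)) \<cdot> a X Y Z"
  using a_naturality[of "\<Phi> X" "\<Phi> Y" "\<Phi> Z"] assms by (simp add: \<Phi>_arr F_\<Phi>)

text \<open>Stated with a trailing factor \<open>f\<close> because composites associate to the right, so that the
  associator to be cancelled never stands at the end of the composite.\<close>

lemma a_inv_\<Phi>:
  assumes "X \<in> Obj C" "Y \<in> Obj C" "Z \<in> Obj C"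
    and f: "f \<in> Arr C" "Cod C f = (X \<otimes>\<^sub>o Y) \<otimes>\<^sub>o F\<^sub>o Z"
  shows "a_inv (G\<^sub>o X) (G\<^sub>o Y) (G\<^sub>o Z) \<cdot> (\<Phi> (F\<^sub>o X) \<otimes>\<^sub>a (\<Phi> Y \<otimes>\<^sub>a \<Phi> Z)) \<cdot> a X Y Z \<cdot> f
    = ((\<Phi> X \<otimes>\<^sub>a \<Phi> Y) \<otimes>\<^sub>a \<Phi> (F\<^sub>o Z)) \<cdot> f"
proof -
  have "(\<Phi> (F\<^sub>o X) \<otimes>\<^sub>a (\<Phi> Y \<otimes>\<^sub>a \<Phi> Z)) \<cdot> a X Y Z \<cdot> f
      = a (G\<^sub>o X) (G\<^sub>o Y) (G\<^sub>o Z) \<cdot> ((\<Phi> X \<otimes>\<^sub>a \<Phi> Y) \<otimes>\<^sub>a \<Phi> (F\<^sub>o Z)) \<cdot> f"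
    using assms arg_cong[OF a_\<Phi>[OF assms(1-3)], of "\<lambda>k. k \<cdot> f"]
    by (simp add: comp_assoc typing)
  then show ?thesis
    using assms by (simp add: a_inv_a_cancel typing)
qed

end

section \<open>Crossings and the Yang-Baxter equation\<close>

context weakly_hom_braided_category
begin

lemma d_arr:
  assumes "V \<in> Obj C" "W \<in> Obj C"
  shows "d V W \<in> Arr C" "Dom C (d V W) = V \<otimes>\<^sub>o W" "Cod C (d V W) = G\<^sub>o W \<otimes>\<^sub>o G\<^sub>o V"
  using nat_trans.component_in_hom[OF d_nat_trans, of "(V, W)"] assms
  by (auto simp: hom_def prod_cat_def)

lemma d_naturality:
  assumes "f \<in> Arr C" "g \<in> Arr C"
  shows "(G\<^sub>a g \<otimes>\<^sub>a G\<^sub>a f) \<cdot> d (Dom C f) (Dom C g) = d (Cod C f) (Cod C g) \<cdot> (f \<otimes>\<^sub>a g)"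
  using nat_trans.naturality[OF d_nat_trans, of "(f, g)" "(Dom C f, Dom C g)"
      "(Cod C f, Cod C g)"] assms
  by (simp add: hom_def prod_cat_def)

lemma d_\<Phi>:
  assumes "X \<in> Obj C" "Y \<in> Obj C"
  shows "d (G\<^sub>o X) (G\<^sub>o Y) \<cdot> (\<Phi> X \<otimes>\<^sub>a \<Phi> Y) = (\<Phi> (G\<^sub>o Y) \<otimes>\<^sub>a \<Phi> (G\<^sub>o X)) \<cdot> d X Y"
  using d_naturality[of "\<Phi> X" "\<Phi> Y"] assms by (simp add: \<Phi>_arr G_\<Phi>)

text \<open>The geometric heart of the argument: the crossing of \<open>V\<close> with \<open>W\<close> passes from after to before
  their joint crossing with \<open>X\<close>. This is naturality at the pair \<open>\<Phi> X, d V W\<close>, made into a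
  statement about crossings by \<open>G (d V W) = d (G V) (G W)\<close>.\<close>

lemma crossing_slides_under:
  assumes "X \<in> Obj C" "V \<in> Obj C" "W \<in> Obj C"
  shows "(d (G\<^sub>o V) (G\<^sub>o W) \<otimes>\<^sub>a \<Phi> (G\<^sub>o X)) \<cdot> d X (V \<otimes>\<^sub>o W)
    = d (G\<^sub>o X) (G\<^sub>o W \<otimes>\<^sub>o G\<^sub>o V) \<cdot> (\<Phi> X \<otimes>\<^sub>a d V W)"
  using d_naturality[of "\<Phi> X" "d V W"] assms by (simp add: \<Phi>_arr d_arr G_\<Phi> G_d)

text \<open>Merging two crossings by \<open>wH1\<close> leaves a factor made of \<open>\<Phi>\<close>'s between the merged crossing and
  the remaining one. That factor is first moved past the remaining crossing, so that the two crossings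
  become adjacent and can be exchanged.\<close>

lemma \<Phi>_crossing_slides_under:
  assumes U: "U \<in> Obj C" and V: "V \<in> Obj C" and W: "W \<in> Obj C"
  shows "(d (G\<^sub>o (G\<^sub>o V)) (G\<^sub>o (G\<^sub>o W)) \<otimes>\<^sub>a \<Phi> (G\<^sub>o (G\<^sub>o (F\<^sub>o U))))
      \<cdot> ((\<Phi> (G\<^sub>o V) \<otimes>\<^sub>a \<Phi> (G\<^sub>o W)) \<otimes>\<^sub>a \<Phi> (G\<^sub>o (F\<^sub>o U))) \<cdot> d (F\<^sub>o U) (V \<otimes>\<^sub>o W)
    = ((\<Phi> (G\<^sub>o (G\<^sub>o W)) \<otimes>\<^sub>a \<Phi> (G\<^sub>o (G\<^sub>o V))) \<otimes>\<^sub>a \<Phi> (G\<^sub>o (G\<^sub>o (F\<^sub>o U))))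
      \<cdot> d (G\<^sub>o (F\<^sub>o U)) (G\<^sub>o W \<otimes>\<^sub>o G\<^sub>o V) \<cdot> (\<Phi> (F\<^sub>o U) \<otimes>\<^sub>a d V W)"
    (is "?l \<cdot> ?m \<cdot> ?d = ?n \<cdot> _")
proof -
  note [simp] = typing d_arr U V W
  let ?k = "d (G\<^sub>o V) (G\<^sub>o W) \<otimes>\<^sub>a \<Phi> (G\<^sub>o (F\<^sub>o U))"
  have "?l \<cdot> ?m = ?n \<cdot> ?k"
    by (simp add: interchange d_\<Phi>)
  moreover have "?l \<cdot> ?m \<cdot> ?d = (?l \<cdot> ?m) \<cdot> ?d"
    by (simp add: comp_assoc)
  moreover have "(?n \<cdot> ?k) \<cdot> ?d = ?n \<cdot> ?k \<cdot> ?d"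
    by (simp add: comp_assoc)
  ultimately show ?thesis
    by (simp add: crossing_slides_under)
qed

lemma yang_baxter_right_in_hom:
  assumes "U \<in> Obj C" "V \<in> Obj C" "W \<in> Obj C"
  shows "yang_baxter_right d U V W \<in> hom C ((U \<otimes>\<^sub>o V) \<otimes>\<^sub>o F\<^sub>o W)
    (F\<^sub>o (G\<^sub>o (G\<^sub>o (G\<^sub>o W))) \<otimes>\<^sub>o (G\<^sub>o (G\<^sub>o (G\<^sub>o V)) \<otimes>\<^sub>o G\<^sub>o (G\<^sub>o (G\<^sub>o U))))"
  using assms by (simp add: yang_baxter_right_def hom_def typing d_arr)

lemma yang_baxter:
  assumes U: "U \<in> Obj C" and V: "V \<in> Obj C" and W: "W \<in> Obj C"
  shows "yang_baxter_left d U V W = yang_baxter_right d U V W"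
proof -
  note [simp] = typing d_arr U V W
  let ?a3 = "a (G\<^sub>o (G\<^sub>o (G\<^sub>o W))) (G\<^sub>o (G\<^sub>o (G\<^sub>o V))) (G\<^sub>o (G\<^sub>o (G\<^sub>o U)))"
  let ?dVW = "d (G\<^sub>o (G\<^sub>o V)) (G\<^sub>o (G\<^sub>o W)) \<otimes>\<^sub>a \<Phi> (G\<^sub>o (G\<^sub>o (F\<^sub>o U)))"
  let ?\<Phi>2 = "\<Phi> (G\<^sub>o (G\<^sub>o (F\<^sub>o W))) \<otimes>\<^sub>a (\<Phi> (G\<^sub>o (G\<^sub>o V)) \<otimes>\<^sub>a \<Phi> (G\<^sub>o (G\<^sub>o U)))"
  let ?\<Phi>2' = "(\<Phi> (G\<^sub>o (G\<^sub>o W)) \<otimes>\<^sub>a \<Phi> (G\<^sub>o (G\<^sub>o V))) \<otimes>\<^sub>a \<Phi> (G\<^sub>o (G\<^sub>o (F\<^sub>o U)))"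
  let ?a2 = "a (G\<^sub>o (G\<^sub>o W)) (G\<^sub>o (G\<^sub>o V)) (G\<^sub>o (G\<^sub>o U))"
  let ?\<Phi>1 = "(\<Phi> (G\<^sub>o V) \<otimes>\<^sub>a \<Phi> (G\<^sub>o W)) \<otimes>\<^sub>a \<Phi> (G\<^sub>o (F\<^sub>o U))"
  let ?dU = "d (F\<^sub>o U) (V \<otimes>\<^sub>o W)"
  let ?dU' = "d (G\<^sub>o (F\<^sub>o U)) (G\<^sub>o W \<otimes>\<^sub>o G\<^sub>o V)"
  let ?s = "(\<Phi> (F\<^sub>o U) \<otimes>\<^sub>a d V W) \<cdot> a U V W"
  have "yang_baxter_left d U V W = ?a3 \<cdot> ?dVW \<cdot> a_inv (G\<^sub>o (G\<^sub>o V)) (G\<^sub>o (G\<^sub>o W)) (G\<^sub>o (G\<^sub>o U))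
      \<cdot> (\<Phi> (G\<^sub>o (F\<^sub>o V)) \<otimes>\<^sub>a (\<Phi> (G\<^sub>o W) \<otimes>\<^sub>a \<Phi> (G\<^sub>o U))) \<cdot> a (G\<^sub>o V) (G\<^sub>o W) (G\<^sub>o U) \<cdot> ?dU \<cdot> a U V W"
    unfolding yang_baxter_left_def wH1[OF U V W, symmetric] ..
  also have "\<dots> = ?a3 \<cdot> ?dVW \<cdot> ?\<Phi>1 \<cdot> ?dU \<cdot> a U V W"
    using a_inv_\<Phi>[of "G\<^sub>o V" "G\<^sub>o W" "G\<^sub>o U" "?dU \<cdot> a U V W"] by simp
  also have "\<dots> = ?a3 \<cdot> (?dVW \<cdot> ?\<Phi>1 \<cdot> ?dU) \<cdot> a U V W"
    by (simp add: comp_assoc)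
  also have "\<dots> = ?a3 \<cdot> (?\<Phi>2' \<cdot> ?dU' \<cdot> (\<Phi> (F\<^sub>o U) \<otimes>\<^sub>a d V W)) \<cdot> a U V W"
    by (simp only: \<Phi>_crossing_slides_under[OF U V W])
  also have "\<dots> = (?a3 \<cdot> ?\<Phi>2') \<cdot> ?dU' \<cdot> ?s"
    by (simp add: comp_assoc)
  also have "\<dots> = (?\<Phi>2 \<cdot> ?a2) \<cdot> ?dU' \<cdot> ?s"
    using a_\<Phi>[of "G\<^sub>o (G\<^sub>o W)" "G\<^sub>o (G\<^sub>o V)" "G\<^sub>o (G\<^sub>o U)"] by simp
  \<comment> \<open>An associator and its inverse are inserted, so that the second use of \<open>wH1\<close> has the associator
    it requires; the inverse is the one of the right-hand side.\<close>
  also have "\<dots> = (?\<Phi>2 \<cdot> ?a2 \<cdot> ?dU' \<cdot> a (G\<^sub>o U) (G\<^sub>o W) (G\<^sub>o V))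
      \<cdot> a_inv (G\<^sub>o U) (G\<^sub>o W) (G\<^sub>o V) \<cdot> ?s"
    by (simp add: comp_assoc a_a_inv_cancel)
  also have "\<dots> = ((\<Phi> (G\<^sub>o (G\<^sub>o (F\<^sub>o W))) \<otimes>\<^sub>a d (G\<^sub>o (G\<^sub>o U)) (G\<^sub>o (G\<^sub>o V)))
      \<cdot> a (G\<^sub>o (G\<^sub>o W)) (G\<^sub>o (G\<^sub>o U)) (G\<^sub>o (G\<^sub>o V)) \<cdot> (d (G\<^sub>o U) (G\<^sub>o W) \<otimes>\<^sub>a \<Phi> (G\<^sub>o (F\<^sub>o V))))
      \<cdot> a_inv (G\<^sub>o U) (G\<^sub>o W) (G\<^sub>o V) \<cdot> ?s"
    using wH1[of "G\<^sub>o U" "G\<^sub>o W" "G\<^sub>o V"] by simp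
  also have "\<dots> = yang_baxter_right d U V W"
    by (simp add: yang_baxter_right_def comp_assoc)
  finally show ?thesis .
qed

end

theorem proposition6p9:
  fixes C :: "('o, 'a) cat"
    and P :: "('o \<times> 'o, 'a \<times> 'a, 'o, 'a) func"
    and F G :: "('o, 'a, 'o, 'a) func"
    and a :: "'o \<Rightarrow> 'o \<Rightarrow> 'o \<Rightarrow> 'a"
    and \<Phi> :: "'o \<Rightarrow> 'a"
    and d :: "'o \<Rightarrow> 'o \<Rightarrow> 'a"
  assumes "weakly_hom_braided_category C P F G a \<Phi> d"
  shows "hom_tensor_data.weak_hom_Yang_Baxter C P F G a \<Phi> d"
proof -
  interpret weakly_hom_braided_category C P F G a \<Phi> d by (rule assms)
  show ?thesis
    unfolding weak_hom_Yang_Baxter_def Let_def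
    by (simp add: yang_baxter yang_baxter_right_in_hom)
qed

end
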